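(* Let $\mathcal{B}(x)=\Gamma(x)^2/\Gamma(2x)$ and $\mathcal{R}(x)=-2\psi(x)-2\gamma$ for $x>0$. The function $$D(x)=\frac{\mathcal{B}(x)-\mathcal{R}(x)}{x^2}=\frac{1}{x^2}\left[\frac{\Gamma(x)^2}{\Gamma(2x)}-\left(-2\psi(x)-2\gamma\right)\right]$$ is decreasing from $(0,\infty)$ onto $(0,2\zeta(3))$.
   Context: $\Gamma$ is the gamma function, $\psi(x)=\frac{d}{dx}\ln\Gamma(x)$ is the psi (digamma) function, $\gamma=-\psi(1)$ is the Euler constant, and $\zeta(s)=\sum_{n=1}^\infty n^{-s}$ is the Riemann zeta function. *)

theory Defs
  imports "HOL-Analysis.Gamma_Function"
begin

text \<open>The Dirichlet series, meaningful for \<open>s > 1\<close>; no analytic continuation is intended.\<close>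
definition zeta :: "real \<Rightarrow> real" where
  "zeta s = (\<Sum>n. real (Suc n) powr (- s))"

definition B_fun :: "real \<Rightarrow> real" where
  "B_fun x = (Gamma x)\<^sup>2 / Gamma (2 * x)"

definition R_fun :: "real \<Rightarrow> real" where
  "R_fun x = - 2 * Digamma x - 2 * euler_mascheroni"

definition D_fun :: "real \<Rightarrow> real" where
  "D_fun x = (B_fun x - R_fun x) / x\<^sup>2"

end

theory Submission
  imports Defs "HOL-Analysis.Equivalence_Lebesgue_Henstock_Integration"
begin

text \<open>
  The difference has the representation
  \<open>B(x) - R(x) = \<integral>\<^sub>0\<^sup>1 (1 - t\<^sup>x) (1 - (1 - t)\<^sup>x) / (t (1 - t)) dt\<close>, and
  \<open>(1 - a\<^sup>x) / x\<close> is positive and strictly decreasing in \<open>x > 0\<close> for \<open>0 < a < 1\<close>; hence so is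
  \<open>D\<close>. By the symmetry \<open>t \<mapsto> 1 - t\<close> the kernel \<open>1 / (t (1 - t))\<close> may be replaced by
  \<open>2 / (1 - t) = 2 \<Sum>\<^sub>n t\<^sup>n\<close>. Each term of the resulting series is a combination of Beta
  values whose sum telescopes, which makes an interchange of sum and integral unnecessary.
  The value at \<open>0\<close> comes from the third order Taylor coefficient of \<open>x (B(x) - R(x))\<close>, and the
  decay at infinity from \<open>\<psi>(n + 1) + \<gamma> = H\<^sub>n \<le> n\<close>.
\<close>

text \<open>With \<open>u = - z * ln a > 0\<close>, the numerator of the derivative at
  \<open>z\<close> is \<open>a powr z * (1 + u) - 1\<close>, negative because
  \<open>1 + u < exp u = a powr (- z)\<close>.\<close>

lemma one_minus_powr_div_less:
  fixes a x y :: real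
  assumes a: "0 < a" "a < 1" and xy: "0 < x" "x < y"
  shows "(1 - a powr y) / y < (1 - a powr x) / x"
proof (rule DERIV_neg_imp_decreasing[OF xy(2)])
  fix z assume "x \<le> z" "z \<le> y"
  hence z: "z > 0" using xy by simp
  have "1 + (- z * ln a) < exp (- z * ln a)"
    using ln_add_one_self_less_self[of "- z * ln a"] z a
    by (smt (verit) exp_ln_iff exp_less_cancel_iff ln_less_zero mult_minus_left mult_pos_neg)
  hence "(1 - z * ln a) * a powr z < 1"
    using a by (simp add: powr_def exp_minus field_simps)
  hence "(- (a powr z * ln a) * z - (1 - a powr z)) / z\<^sup>2 < 0"
    using z by (simp add: divide_neg_pos algebra_simps)
  moreover have "((\<lambda>z. (1 - a powr z) / z) has_real_derivative
      (- (a powr z * ln a) * z - (1 - a powr z)) / z\<^sup>2) (at z)"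
    using a z by (auto intro!: derivative_eq_intros simp: power2_eq_square)
  ultimately show "\<exists>d. ((\<lambda>z. (1 - a powr z) / z) has_real_derivative d) (at z) \<and> d < 0"
    by blast
qed

section \<open>Beta integrals and the series for the difference\<close>

lemma Beta_1_right: "Beta a 1 = 1 / (a :: real)" if "a > 0"
proof -
  have "a \<notin> \<int>\<^sub>\<le>\<^sub>0" using that by (auto simp: nonpos_Ints_def)
  thus ?thesis using that by (simp add: Beta_def Gamma_plus1 Gamma_eq_zero_iff)
qed

text \<open>For \<open>n > 0\<close> the Beta value is
  \<open>Gamma_series x n * real n powr (- x)\<close>, and the first factor converges to
  \<open>Gamma x\<close>.\<close>

lemma tendsto_Beta_of_nat_left:
  fixes x :: real
  assumes x: "x > 0"
  shows "(\<lambda>n. Beta (real n + 1) x) \<longlonglongrightarrow> 0"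
proof -
  have "(\<lambda>n. real n powr (-x)) \<longlonglongrightarrow> 0"
    using x by (intro tendsto_neg_powr filterlim_real_sequentially) auto
  from tendsto_mult[OF Gamma_series_LIMSEQ[of x] this]
  have "(\<lambda>n. Gamma_series x n * real n powr (-x)) \<longlonglongrightarrow> 0" by simp
  moreover have "eventually (\<lambda>n. Gamma_series x n * real n powr (-x) = Beta (real n + 1) x) sequentially"
    using eventually_gt_at_top[of 0]
  proof eventually_elim
    case (elim n)
    have "x \<notin> \<int>\<^sub>\<le>\<^sub>0" using x by auto
    from pochhammer_Gamma[OF this, of "n + 1"] have "pochhammer x (n + 1) = Gamma (x + (1 + real n)) / Gamma x"
      by (simp only: of_nat_add of_nat_1 add.commute[of "real n"])
    moreover have "Gamma (1 + real n) = fact n" by (rule Gamma_fact)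
    moreover have "Gamma x > 0" "Gamma (x + (1 + real n)) > 0" using x by (auto intro!: Gamma_real_pos)
    ultimately show ?case using elim x
      by (simp add: Gamma_series_def Beta_def powr_def exp_minus add_ac del: pochhammer_Suc)
  qed
  ultimately show ?thesis by (rule Lim_transform_eventually)
qed

text \<open>A term of the expansion of \<open>1 / (1 - t)\<close> times the common numerator. The
  factor 2 from the symmetrisation is left out, hence the halves in the sums below.\<close>

definition integrand :: "nat \<Rightarrow> real \<Rightarrow> real \<Rightarrow> real" where
  "integrand n x t = t ^ n * ((1 - t powr x) * (1 - (1 - t) powr x))"

lemma continuous_on_integrand:
  assumes "x > 0"
  shows "continuous_on {0..1} (integrand n x)"
  unfolding integrand_def using assms
  by (intro continuous_intros continuous_on_powr') auto

lemma has_integral_integrand: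
  assumes x: "x > 0"
  shows "(integrand n x has_integral
    (1 / (real n + 1) - 1 / (real n + 1 + x)
      - Beta (real n + 1) (x + 1) + Beta (real n + 1 + x) (x + 1))) {0..1}"
proof -
  \<comment> \<open>On the open interval both bases are positive; at the endpoints
    \<open>0 powr 0 = 0\<close> would spoil the match with \<open>t ^ n\<close> and with the
    constant 1.\<close>
  have beta: "((\<lambda>t. t powr (a - 1) * (1 - t) powr (b - 1)) has_integral Beta a b) {0<..<1}"
    if "a > 0" "b > 0" for a b :: real
    using has_integral_Beta_real[OF that] by (simp add: has_integral_Icc_iff_Ioo)
  let ?b = "\<lambda>a b t. t powr (a - 1) * (1 - t) powr (b - 1) :: real"
  have "((\<lambda>t. ?b (real n + 1) 1 t - ?b (real n + 1 + x) 1 t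
      - ?b (real n + 1) (x + 1) t + ?b (real n + 1 + x) (x + 1) t) has_integral
      (Beta (real n + 1) 1 - Beta (real n + 1 + x) 1
      - Beta (real n + 1) (x + 1) + Beta (real n + 1 + x) (x + 1))) {0<..<1}"
    using x by (intro has_integral_add has_integral_diff beta) auto
  also have "?this \<longleftrightarrow> (integrand n x has_integral
      (Beta (real n + 1) 1 - Beta (real n + 1 + x) 1
      - Beta (real n + 1) (x + 1) + Beta (real n + 1 + x) (x + 1))) {0<..<1}"
    by (intro has_integral_cong)
      (auto simp: integrand_def powr_add powr_realpow algebra_simps)
  finally show ?thesis
    using x by (simp add: has_integral_Icc_iff_Ioo Beta_1_right)
qed

lemma sums_integral_integrand:
  assumes x: "x > 0"
  shows "(\<lambda>n. integral {0..1} (integrand n x)) sums ((B_fun x - R_fun x) / 2)"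
proof -
  \<comment> \<open>Raising the second argument becomes a difference in the first one, so both Beta
    series telescope.\<close>
  have step: "Beta a (x + 1) = Beta a x - Beta (a + 1) x" if "a > 0" for a :: real
    using that x Beta_plus1_plus1[of a x] by (auto simp: nonpos_Ints_def)
  have lim: "(\<lambda>n. Beta (real n + 1 + x) x) \<longlonglongrightarrow> 0"
  proof (rule tendsto_sandwich[OF _ _ tendsto_const tendsto_Beta_of_nat_left[OF x]])
    show "\<forall>\<^sub>F n in sequentially. 0 \<le> Beta (real n + 1 + x) x"
      using x by (intro always_eventually) (auto simp: Beta_def intro!: Gamma_real_nonneg)
    show "\<forall>\<^sub>F n in sequentially. Beta (real n + 1 + x) x \<le> Beta (real n + 1) x"
      using x by (intro always_eventually allI Beta_real_mono) auto
  qed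
  have "(\<lambda>n. Beta (real n + 1) x - Beta (real (Suc n) + 1) x) sums (Beta (real 0 + 1) x - 0)"
    by (intro telescope_sums' tendsto_Beta_of_nat_left x)
  moreover have "Beta (real n + 1) (x + 1) = Beta (real n + 1) x - Beta (real (Suc n) + 1) x" for n
    by (subst step) (simp_all add: add_ac)
  ultimately have s1: "(\<lambda>n. Beta (real n + 1) (x + 1)) sums (1 / x)"
    using x by (simp add: Beta_commute[of 1 x] Beta_1_right)
  have "(\<lambda>n. Beta (real n + 1 + x) x - Beta (real (Suc n) + 1 + x) x) sums (Beta (real 0 + 1 + x) x - 0)"
    by (intro telescope_sums' lim)
  moreover have "Beta (real n + 1 + x) (x + 1) = Beta (real n + 1 + x) x - Beta (real (Suc n) + 1 + x) x" for n
    using x by (subst step) (simp_all add: add_ac)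
  ultimately have s2: "(\<lambda>n. Beta (real n + 1 + x) (x + 1)) sums Beta (x + 1) x"
    by (simp add: add.commute)
  \<comment> \<open>Taking the Digamma series at \<open>x + 1\<close> produces an extra
    \<open>1 / x\<close>, which cancels against the sum in \<open>s1\<close>.\<close>
  have "(\<lambda>n. inverse (real (Suc n)) - inverse ((x + 1) + real n)) sums (Digamma (x + 1) + euler_mascheroni)"
    using summable_sums[OF summable_Digamma[of "x + 1"]] x by (simp add: Digamma_def)
  hence s3: "(\<lambda>n. 1 / (real n + 1) - 1 / (real n + 1 + x)) sums (Digamma x + 1 / x + euler_mascheroni)"
    using x Digamma_plus1[of x] by (simp add: inverse_eq_divide add_ac)
  have "x \<notin> \<int>\<^sub>\<le>\<^sub>0" using x by (auto simp: nonpos_Ints_def)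
  hence "2 * Beta (x + 1) x = Beta x x"
    using Beta_plus1_left[of x x] x by simp
  also have "Beta x x = B_fun x"
    by (simp add: B_fun_def Beta_def power2_eq_square)
  finally have B: "Beta (x + 1) x = B_fun x / 2" by linarith
  have "(\<lambda>n. integral {0..1} (integrand n x)) =
    (\<lambda>n. 1 / (real n + 1) - 1 / (real n + 1 + x)
      - Beta (real n + 1) (x + 1) + Beta (real n + 1 + x) (x + 1))"
    using has_integral_integrand[OF x] by (auto simp: integral_unique)
  moreover have "(B_fun x - R_fun x) / 2 = (Digamma x + 1 / x + euler_mascheroni) - 1 / x + Beta (x + 1) x"
    unfolding B by (simp add: R_fun_def field_simps)
  ultimately show ?thesis
    using sums_add[OF sums_diff[OF s3 s1] s2] by (simp only:)
qed

section \<open>Strict monotonicity and sign\<close>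

text \<open>Dividing by the square gives each of the bases \<open>t\<close> and \<open>1 - t\<close>
  its own factor \<open>(1 - a powr x) / x\<close>; both factors are nonnegative and strictly
  decreasing in \<open>x\<close>.\<close>

lemma integral_integrand_div_less:
  assumes xy: "0 < x" "x < y"
  shows "integral {0..1} (integrand n y) / y\<^sup>2 < integral {0..1} (integrand n x) / x\<^sup>2"
proof -
  have "integral {0..1} (\<lambda>t. integrand n y t / y\<^sup>2) < integral {0..1} (\<lambda>t. integrand n x t / x\<^sup>2)"
  proof (rule integral_less_real)
    fix t :: real assume "t \<in> {0<..<1}"
    hence t: "0 < t" "t < 1" by auto
    have nonneg: "0 \<le> (1 - a powr y) / y" if "0 < a" "a < 1" for a
      using that xy by (simp add: powr_le1)
    have "(1 - t powr y) / y * ((1 - (1 - t) powr y) / y) < (1 - t powr x) / x * ((1 - (1 - t) powr x) / x)"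
      using t xy by (intro mult_strict_mono' one_minus_powr_div_less nonneg) auto
    moreover have "t ^ n > 0" using t by simp
    ultimately have "t ^ n * ((1 - t powr y) / y * ((1 - (1 - t) powr y) / y))
        < t ^ n * ((1 - t powr x) / x * ((1 - (1 - t) powr x) / x))" 
      by (rule mult_strict_left_mono)
    thus "integrand n y t / y\<^sup>2 < integrand n x t / x\<^sup>2"
      by (simp add: integrand_def power2_eq_square)
  qed (use xy in \<open>auto intro!: continuous_intros continuous_on_integrand\<close>)
  thus ?thesis by simp
qed

lemma D_fun_sums:
  assumes "x > 0"
  shows "(\<lambda>n. integral {0..1} (integrand n x) / x\<^sup>2) sums (D_fun x / 2)"
  using sums_divide[OF sums_integral_integrand[OF assms], of "x\<^sup>2"]
  by (simp add: D_fun_def mult.commute)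

lemma D_fun_nonneg:
  assumes x: "x > 0"
  shows "D_fun x \<ge> 0"
proof -
  have "integral {0..1} (integrand n x) \<ge> 0" for n
    using has_integral_integrand[OF x, of n] x
    by (intro integral_nonneg) (auto simp: integrand_def powr_le1)
  hence "0 \<le> D_fun x / 2"
    by (intro sums_le[OF _ sums_zero D_fun_sums[OF x]]) auto
  thus ?thesis by simp
qed

lemma D_fun_strict_antimono: "strict_antimono_on {0<..} D_fun"
proof (rule monotone_onI)
  fix x y :: real assume "x \<in> {0<..}" "y \<in> {0<..}" and xy: "x < y"
  hence pos: "x > 0" "y > 0" by auto
  have "(\<lambda>n. integral {0..1} (integrand n x) / x\<^sup>2 - integral {0..1} (integrand n y) / y\<^sup>2)
      sums (D_fun x / 2 - D_fun y / 2)"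
    by (intro sums_diff D_fun_sums pos)
  moreover have "0 < integral {0..1} (integrand n x) / x\<^sup>2 - integral {0..1} (integrand n y) / y\<^sup>2" for n
    using integral_integrand_div_less[OF pos(1) xy] by simp
  ultimately have "0 < D_fun x / 2 - D_fun y / 2"
    by (metis (no_types, lifting) sums_summable sums_unique suminf_pos)
  thus "D_fun y < D_fun x" by simp
qed

section \<open>Behaviour at infinity and at the origin\<close>

text \<open>At \<open>n + 1\<close> the Beta part is at most \<open>Beta 1 1 = 1\<close> and the
  Digamma part is \<open>2 * harm n \<le> 2 * n\<close>, so the numerator is at most
  \<open>2 * n + 1\<close>.\<close>

lemma D_fun_Suc_le: "D_fun (real (Suc n)) \<le> 2 / real (Suc n)"
proof -
  have "harm n \<le> real n"
    unfolding harm_def by (rule order.trans[OF sum_bounded_above[where K = 1]]) (auto simp: field_simps)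
  moreover have "Digamma (real (Suc n)) = harm n - euler_mascheroni"
    by (rule Digamma_of_nat)
  moreover have "Beta (real (Suc n)) (real (Suc n)) \<le> Beta 1 1"
    by (rule Beta_real_mono) auto
  hence "B_fun (real (Suc n)) \<le> 1"
    unfolding Beta_def B_fun_def power2_eq_square by (simp add: Gamma_numeral flip: mult_2)
  ultimately have "B_fun (real (Suc n)) - R_fun (real (Suc n)) \<le> 2 * real (Suc n)"
    by (simp add: R_fun_def)
  hence "D_fun (real (Suc n)) \<le> 2 * real (Suc n) / (real (Suc n))\<^sup>2"
    unfolding D_fun_def by (intro divide_right_mono) auto
  thus ?thesis by (simp add: power2_eq_square del: of_nat_Suc)
qed

lemma Polygamma_2_1: "Polygamma 2 1 = - 2 * zeta 3"
proof -
  have "(\<lambda>k. inverse ((1 + real k) ^ Suc 2)) sums ((-1) ^ Suc 2 * Polygamma 2 1 / fact 2)"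
    by (rule Polygamma_LIMSEQ) auto
  moreover have "inverse ((1 + real k) ^ Suc 2) = real (Suc k) powr (- 3)" for k
    using powr_realpow[of "real (Suc k)" 3] by (simp add: powr_minus add_ac eval_nat_numeral)
  ultimately have "(\<lambda>k. real (Suc k) powr (- 3)) sums (- Polygamma 2 1 / 2)"
    by (simp add: fact_numeral)
  thus ?thesis unfolding zeta_def by (simp add: sums_iff)
qed

text \<open>Here \<open>f1\<close>, \<open>f2\<close>, \<open>f3\<close> are the successive
  derivatives of \<open>f0\<close>. Since \<open>f0\<close>, \<open>f1\<close>, \<open>f2\<close>
  vanish at 0, the limit of \<open>f0 x / x ^ 3\<close> is \<open>f3 0 / 6\<close>.\<close>

lemma D_fun_tendsto_0: "(D_fun \<longlongrightarrow> 2 * zeta 3) (at_right 0)"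
proof -
  \<comment> \<open>\<open>f0 x = x (B(x) - R(x))\<close>, written so as to be smooth at \<open>0\<close>;
    \<open>g1\<close> is the logarithmic derivative of \<open>F\<close>.\<close>
  define P where "P = (\<lambda>k. Polygamma k :: real \<Rightarrow> real)"
  define F where "F = (\<lambda>x::real. (Gamma (1 + x))\<^sup>2 / Gamma (1 + 2 * x))"
  define g1 where "g1 = (\<lambda>x. 2 * P 0 (1 + x) - 2 * P 0 (1 + 2 * x))"
  define g2 where "g2 = (\<lambda>x. 2 * P 1 (1 + x) - 4 * P 1 (1 + 2 * x))"
  define g3 where "g3 = (\<lambda>x. 2 * P 2 (1 + x) - 8 * P 2 (1 + 2 * x))"
  define f0 where "f0 = (\<lambda>x. 2 * F x - 2 + 2 * x * P 0 (1 + x) + 2 * x * euler_mascheroni)"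
  define f1 where "f1 = (\<lambda>x. 2 * (g1 x * F x) + 2 * P 0 (1 + x) + 2 * x * P 1 (1 + x) + 2 * euler_mascheroni)"
  define f2 where "f2 = (\<lambda>x. 2 * ((g2 x + (g1 x)\<^sup>2) * F x) + 4 * P 1 (1 + x) + 2 * x * P 2 (1 + x))"
  define f3 where "f3 = (\<lambda>x. 2 * ((g3 x + 3 * g1 x * g2 x + (g1 x) ^ 3) * F x) + 6 * P 2 (1 + x) + 2 * x * P 3 (1 + x))"
  have nz: "1 + x \<notin> \<int>\<^sub>\<le>\<^sub>0" "1 + 2 * x \<notin> \<int>\<^sub>\<le>\<^sub>0" if "x \<ge> 0" for x :: real
    using that by (auto simp: nonpos_Ints_def)
  have dP: "((\<lambda>x. P k (1 + x)) has_real_derivative P (Suc k) (1 + x)) (at x)"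
           "((\<lambda>x. P k (1 + 2 * x)) has_real_derivative 2 * P (Suc k) (1 + 2 * x)) (at x)"
    if "x \<ge> 0" for k x
    unfolding P_def using nz[OF that] by (auto intro!: derivative_eq_intros)
  \<comment> \<open>The instances are rewritten so that the orders read 1, 2, 3 as in the
    definitions above, not as successors.\<close>
  note dP = dP[where k = 0, simplified] dP[where k = 1, simplified] dP[where k = 2, simplified]
  note dP = dP[folded numeral_2_eq_2 numeral_3_eq_3, unfolded One_nat_def[symmetric]]
  have dF: "(F has_real_derivative g1 x * F x) (at x)" if "x \<ge> 0" for x
    unfolding F_def using nz[OF that] Gamma_eq_zero_iff[of "1 + 2 * x"]
    by (auto intro!: derivative_eq_intros simp: g1_def P_def power2_eq_square field_simps)
  have dg1: "(g1 has_real_derivative g2 x) (at x)" if "x \<ge> 0" for x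
    unfolding g1_def g2_def by (rule derivative_eq_intros dP that refl)+ simp
  have dg2: "(g2 has_real_derivative g3 x) (at x)" if "x \<ge> 0" for x
    unfolding g2_def g3_def by (rule derivative_eq_intros dP that refl)+ simp
  have d0: "(f0 has_real_derivative f1 x) (at x)" if "x \<ge> 0" for x
    unfolding f0_def f1_def by (rule derivative_eq_intros dP dF that refl)+ (simp add: algebra_simps)
  have d1: "(f1 has_real_derivative f2 x) (at x)" if "x \<ge> 0" for x
    unfolding f1_def f2_def
    by (rule derivative_eq_intros dP dF dg1 that refl)+ (simp add: algebra_simps power2_eq_square)
  have d2: "(f2 has_real_derivative f3 x) (at x)" if "x \<ge> 0" for x
    unfolding f2_def f3_def
    by (rule derivative_eq_intros dP dF dg1 dg2 that refl)+ (simp add: algebra_simps power2_eq_square power3_eq_cube)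
  \<comment> \<open>As \<open>g1 0 = 0\<close> and \<open>F 0 = 1\<close>, \<open>f3 0\<close> is
    \<open>2 * g3 0 + 6 * P 2 1\<close> with \<open>g3 0 = - 6 * P 2 1\<close>, that is
    \<open>- 6 * P 2 1\<close>.\<close>
  have at0: "f0 0 = 0" "f1 0 = 0" "f2 0 = 0" "f3 0 = 12 * zeta 3"
    by (simp_all add: f0_def f1_def f2_def f3_def g1_def g2_def g3_def F_def P_def Polygamma_2_1)
  have lim0: "(f \<longlongrightarrow> 0) (at_right 0)"
    if "f 0 = 0" "\<And>x. x \<ge> 0 \<Longrightarrow> (f has_real_derivative f' x) (at x)" for f f' :: "real \<Rightarrow> real"
    using DERIV_isCont[OF that(2)[of 0]] that(1)
    by (metis isCont_def filterlim_at_split order.refl)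
  have pos: "eventually (\<lambda>x. x > 0) (at_right (0::real))"
    by (simp add: eventually_at_right_less)
  \<comment> \<open>The innermost limit is the difference quotient of \<open>f2\<close> at 0; two
    applications of l'Hospital's rule then lead back to \<open>f0\<close>.\<close>
  have "((\<lambda>x. (f2 x - f2 0) / (x - 0)) \<longlongrightarrow> f3 0) (at_right 0)"
    using d2[of 0] by (auto simp: has_field_derivative_iff filterlim_at_split)
  hence "((\<lambda>x. 1 / 6 * (f2 x / x)) \<longlongrightarrow> 1 / 6 * (12 * zeta 3)) (at_right 0)"
    unfolding at0 by (intro tendsto_mult tendsto_const) simp
  hence l2: "((\<lambda>x. f2 x / (6 * x)) \<longlongrightarrow> 2 * zeta 3) (at_right 0)"
    by simp
  have l1: "((\<lambda>x. f1 x / (3 * x\<^sup>2)) \<longlongrightarrow> 2 * zeta 3) (at_right 0)"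
    by (rule lhopital_right_0[where f' = f2 and g' = "\<lambda>x. 6 * x", OF lim0[OF at0(2) d1] _ _ _ _ _ l2])
      (auto intro!: tendsto_eq_intros derivative_eq_intros eventually_mono[OF pos] d1)
  have "((\<lambda>x. f0 x / x ^ 3) \<longlongrightarrow> 2 * zeta 3) (at_right 0)"
    by (rule lhopital_right_0[where f' = f1 and g' = "\<lambda>x. 3 * x\<^sup>2", OF lim0[OF at0(1) d0] _ _ _ _ _ l1])
      (auto intro!: tendsto_eq_intros derivative_eq_intros eventually_mono[OF pos] d0)
  moreover have "eventually (\<lambda>x. f0 x / x ^ 3 = D_fun x) (at_right 0)"
    using pos
  proof eventually_elim
    case (elim x)
    have "x \<notin> \<int>\<^sub>\<le>\<^sub>0" "2 * x \<notin> \<int>\<^sub>\<le>\<^sub>0"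
      using elim by (auto simp: nonpos_Ints_def)
    \<comment> \<open>These recurrences turn \<open>2 * F x\<close> into \<open>x * B_fun x\<close>;
      the \<open>1 / x\<close> from shifting Digamma cancels the constant \<open>- 2\<close> in
      \<open>f0\<close>.\<close>
    hence "Gamma (1 + x) = x * Gamma x" "Gamma (1 + 2 * x) = 2 * x * Gamma (2 * x)"
      using Gamma_plus1[of x] Gamma_plus1[of "2 * x"] by (auto simp: add_ac)
    hence "F x = x * B_fun x / 2"
      using elim by (simp add: F_def B_fun_def power2_eq_square mult_ac)
    moreover have "P 0 (1 + x) = Digamma x + 1 / x"
      using elim Digamma_plus1[of x] by (simp add: P_def add_ac)
    ultimately have "f0 x = x * (B_fun x - R_fun x)"
      using elim by (simp add: f0_def R_fun_def algebra_simps)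
    thus ?case
      using elim by (simp add: D_fun_def power2_eq_square power3_eq_cube)
  qed
  ultimately show ?thesis by (rule Lim_transform_eventually)
qed

section \<open>Continuity and the range\<close>

lemma isCont_D_fun: "isCont D_fun x" if "x > 0"
proof -
  have "x \<notin> \<int>\<^sub>\<le>\<^sub>0" "2 * x \<notin> \<int>\<^sub>\<le>\<^sub>0" using that by (auto simp: nonpos_Ints_def)
  thus ?thesis using that unfolding D_fun_def[abs_def] B_fun_def R_fun_def
    by (intro continuous_intros) (auto simp: Gamma_eq_zero_iff)
qed

theorem theorem6:
  shows "strict_antimono_on {0<..} D_fun \<and> D_fun ` {0<..} = {0<..<2 * zeta 3}"
proof (intro conjI equalityI subsetI)
  show "strict_antimono_on {0<..} D_fun" by (rule D_fun_strict_antimono)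
  note less = monotone_onD[OF this]
  have small: "\<exists>y>x. D_fun y < e" if "e > 0" for x e
  proof -
    obtain n where n: "real n > max x (2 / e)" using reals_Archimedean2 by blast
    have "2 / real (Suc n) < e" using n that by (simp add: field_simps)
    with D_fun_Suc_le[of n] n show ?thesis by (intro exI[of _ "real (Suc n)"]) auto
  qed
  {
    fix y assume "y \<in> D_fun ` {0<..}"
    then obtain x where x: "x > 0" "y = D_fun x" by auto
    \<comment> \<open>Comparison with a larger argument makes the weak lower bound strict.\<close>
    have "D_fun (x + 1) < D_fun x" using x by (intro less) auto
    with D_fun_nonneg[of "x + 1"] x have "D_fun x > 0" by simp
    moreover have "D_fun x < 2 * zeta 3"
    proof -
      \<comment> \<open>The limit at 0 bounds \<open>D_fun (x / 2)\<close> only weakly; strictness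
        comes from the passage from \<open>x\<close> to \<open>x / 2\<close>.\<close>
      have "D_fun x < D_fun (x / 2)" using x by (intro less) auto
      also have "D_fun (x / 2) \<le> 2 * zeta 3"
      proof (rule tendsto_lowerbound[OF D_fun_tendsto_0])
        show "eventually (\<lambda>z. D_fun (x / 2) \<le> D_fun z) (at_right 0)"
          using eventually_at_right_less[of 0] eventually_at_right_real[of 0 "x / 2"] x
          by (auto elim!: eventually_mono intro!: less_imp_le less)
      qed simp
      finally show ?thesis .
    qed
    ultimately show "y \<in> {0<..<2 * zeta 3}" using x by auto
  }
  \<comment> \<open>Surjectivity: \<open>y\<close> is enclosed between a value near 0, exceeding it
    by the limit, and a value far out, below it by the decay.\<close>
  fix y assume y: "y \<in> {0<..<2 * zeta 3}"
  hence "eventually (\<lambda>z. y < D_fun z) (at_right 0)"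
    using order_tendstoD(1)[OF D_fun_tendsto_0] by auto
  with eventually_at_right_less[of "0::real"] have "eventually (\<lambda>z. 0 < z \<and> y < D_fun z) (at_right 0)"
    by eventually_elim auto
  then obtain a where a: "a > 0" "D_fun a > y"
    using eventually_happens'[of "at_right (0::real)"] by auto
  obtain b where b: "b > a" "D_fun b < y" using small y by auto
  have "\<exists>x\<ge>a. x \<le> b \<and> D_fun x = y"
    using a b by (intro IVT2) (auto intro!: isCont_D_fun)
  thus "y \<in> D_fun ` {0<..}" using a by force
qed

end
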